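(* Let $n\ge4$ be even and $0\le\varepsilon\le\frac{\pi}{2n}$. For $k=1,\dots,n$ define qubit observables $$N_k^{(j)}=\cos\left[\tfrac{k\pi}{n}+(-1)^k\varepsilon\right]\sigma_x+\sin\left[\tfrac{k\pi}{n}+(-1)^k\varepsilon\right]\sigma_y\quad (1\le j\le \tfrac n2),$$ $$N_k^{(j)}=\cos\left[\tfrac{k\pi}{n}-(-1)^k\varepsilon\right]\sigma_x+\sin\left[\tfrac{k\pi}{n}-(-1)^k\varepsilon\right]\sigma_y\quad (\tfrac n2<j\le n),$$ and the $n$-qubit operator $$\mathcal W^{\varepsilon}=\frac12\left[\mathbb 1^{\otimes n}-\sum_{\ell=\pm1}\left(\frac{\mathbb 1+\ell\,\sigma_z}{2}\right)^{\otimes n}-\sum_{k=1}^n\frac{(-1)^k}{n}\bigotimes_{j=1}^nN_k^{(j)}\right].$$ Let $|\psi_n\rangle$ be the $n$-qubit biseparable state $$|\psi_n\rangle=\frac12\left(|0\rangle^{\otimes\frac n2}+e^{i\pi/4}|1\rangle^{\otimes\frac n2}\right)\otimes\left(|0\rangle^{\otimes\frac n2}+e^{-i\pi/4}|1\rangle^{\otimes\frac n2}\right).$$ Then $$\langle\psi_n|\mathcal W^{\varepsilon}|\psi_n\rangle=-\frac14\sin n\varepsilon ,$$ which is negative as soon as $\varepsilon>0$. Thus the misaligned evaluation of the genuine $n$-partite entanglement witness $\mathcal W_{\mathrm{GHZ}}$ (see context) on a biseparable state erroneously certifies genuine $n$-partite entanglement for every such $\varepsilon>0$.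
   Context: $\sigma_x,\sigma_y,\sigma_z$ are the Pauli matrices, and $|0\rangle,|1\rangle$ are the eigenvectors of $\sigma_z$ with eigenvalues $+1,-1$. A witness for genuine $n$-partite entanglement is a Hermitian observable $\mathcal W$ with $\mathrm{tr}(\mathcal W\rho)\ge0$ for all biseparable states $\rho$ (mixtures of pure states that are each a product with respect to some bipartition of the $n$ qubits), and negative expectation on some state; a negative value is read as certifying genuine $n$-partite entanglement. The witness is $\mathcal W_{\mathrm{GHZ}}=\frac12\mathbb 1^{\otimes n}-|\mathrm{GHZ}\rangle\langle\mathrm{GHZ}|$ with $|\mathrm{GHZ}\rangle=\frac1{\sqrt2}(|0\rangle^{\otimes n}+|1\rangle^{\otimes n})$. It is evaluated through the decomposition $$\mathcal W_{\mathrm{GHZ}}=\frac12\left[\mathbb 1^{\otimes n}-\sum_{\ell=\pm1}\left(\frac{\mathbb 1+\ell\sigma_z}{2}\right)^{\otimes n}-\sum_{k=1}^n\frac{(-1)^k}{n}\bigotimes_{j=1}^nM_k^{(j)}\right],$$ with intended local observables $M_k^{(j)}=\cos\frac{k\pi}{n}\sigma_x+\sin\frac{k\pi}{n}\sigma_y$ and $\sigma_z$. The operator $\mathcal W^\varepsilon$ is obtained by replacing each $M_k^{(j)}$ by the actually measured $N_k^{(j)}$, whose Bloch direction deviates from that of $M_k^{(j)}$ by the angle $\varepsilon$; the $\sigma_z$ measurement is unperturbed. *)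

theory Defs
  imports
    Complex_Main
    "Jordan_Normal_Form.Matrix"
    "Jordan_Normal_Form.Schur_Decomposition"
begin

section \<open>Linear algebra on top of the matrix library\<close>

definition trace :: "complex mat \<Rightarrow> complex" where
  "trace A = (\<Sum>i<dim_row A. A $$ (i, i))"

definition hermitian :: "complex mat \<Rightarrow> bool" where
  "hermitian A \<longleftrightarrow> mat_adjoint A = A"

definition ketbra :: "complex vec \<Rightarrow> complex vec \<Rightarrow> complex mat" where
  "ketbra v w = mat (dim_vec v) (dim_vec w) (\<lambda>(r, c). v $ r * cnj (w $ c))"

text \<open>The library product \<open>v \<bullet>c w\<close> conjugates its second argument,
  so this is the expectation value \<open>\<langle>v|A|v\<rangle>\<close>.\<close>

definition expectation :: "complex mat \<Rightarrow> complex vec \<Rightarrow> complex" where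
  "expectation A v = (A *\<^sub>v v) \<bullet>c v"

definition mat_Sum :: "nat \<Rightarrow> ('i \<Rightarrow> complex mat) \<Rightarrow> 'i set \<Rightarrow> complex mat" where
  "mat_Sum d F I = mat d d (\<lambda>(r, c). \<Sum>i\<in>I. F i $$ (r, c))"

text \<open>Kronecker products; the left factor carries the most significant part of the index.\<close>

definition kron_vec :: "complex vec \<Rightarrow> complex vec \<Rightarrow> complex vec" where
  "kron_vec u v =
     vec (dim_vec u * dim_vec v) (\<lambda>i. u $ (i div dim_vec v) * v $ (i mod dim_vec v))"

definition kron_mat :: "complex mat \<Rightarrow> complex mat \<Rightarrow> complex mat" where
  "kron_mat A B =
     mat (dim_row A * dim_row B) (dim_col A * dim_col B)
       (\<lambda>(r, c). A $$ (r div dim_row B, c div dim_col B)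
               * B $$ (r mod dim_row B, c mod dim_col B))"

definition tensor_vec :: "complex vec list \<Rightarrow> complex vec" where
  "tensor_vec vs = foldr kron_vec vs (vec 1 (\<lambda>_. 1))"

definition tensor_mat :: "complex mat list \<Rightarrow> complex mat" where
  "tensor_mat As = foldr kron_mat As (1\<^sub>m 1)"


section \<open>Qubits\<close>

definition ket0 :: "complex vec" where "ket0 = vec_of_list [1, 0]"
definition ket1 :: "complex vec" where "ket1 = vec_of_list [0, 1]"

definition sigma_x :: "complex mat" where
  "sigma_x = mat_of_rows_list 2 [[0, 1], [1, 0]]"

definition sigma_y :: "complex mat" where
  "sigma_y = mat_of_rows_list 2 [[0, - \<i>], [\<i>, 0]]"

definition sigma_z :: "complex mat" where
  "sigma_z = mat_of_rows_list 2 [[1, 0], [0, - 1]]"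

text \<open>Value of qubit \<open>j \<in> {1..n}\<close> in the computational basis vector with index \<open>i < 2 ^ n\<close>.\<close>

definition qubit :: "nat \<Rightarrow> nat \<Rightarrow> nat \<Rightarrow> nat" where
  "qubit n i j = i div 2 ^ (n - j) mod 2"

definition ones :: "nat \<Rightarrow> nat \<Rightarrow> nat set" where
  "ones n i = {j \<in> {1..n}. qubit n i j = 1}"

text \<open>This numbering of the qubits is the order of the factors of a tensor product.\<close>

lemma dim_tensor_vec:
  assumes "\<forall>v\<in>set vs. dim_vec v = 2"
  shows "dim_vec (tensor_vec vs) = 2 ^ length vs"
  using assms by (induction vs) (auto simp: tensor_vec_def kron_vec_def)

lemma tensor_vec_index:
  assumes "\<forall>v\<in>set vs. dim_vec v = 2" and "i < 2 ^ length vs"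
  shows "tensor_vec vs $ i = (\<Prod>j=1..length vs. (vs ! (j - 1)) $ qubit (length vs) i j)"
  using assms
proof (induction vs arbitrary: i)
  case Nil
  then show ?case by (simp add: tensor_vec_def)
next
  case (Cons v vs)
  let ?n = "length vs"
  have d: "dim_vec (tensor_vec vs) = 2 ^ ?n" using Cons.prems dim_tensor_vec by simp
  have dv: "dim_vec v = 2" using Cons.prems by simp
  have bit: "qubit ?n (i mod 2 ^ ?n) j = qubit (Suc ?n) i (Suc j)" if "j \<in> {1..?n}" for j
  proof -
    have "i mod 2 ^ ?n = i mod (2 ^ (?n - j) * 2 ^ j)"
      using that by (simp flip: power_add)
    then have "i mod 2 ^ ?n div 2 ^ (?n - j) = i div 2 ^ (?n - j) mod 2 ^ j"
      by (simp add: mod_mult2_eq)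
    moreover have "i div 2 ^ (?n - j) mod 2 ^ j mod 2 = i div 2 ^ (?n - j) mod 2"
      using that by (intro mod_mod_cancel) auto
    ultimately show ?thesis by (simp add: qubit_def)
  qed
  have "tensor_vec (v # vs) $ i
      = v $ (i div 2 ^ ?n) * tensor_vec vs $ (i mod 2 ^ ?n)"
    using Cons.prems d dv by (simp add: tensor_vec_def kron_vec_def)
  also have "tensor_vec vs $ (i mod 2 ^ ?n)
      = (\<Prod>j=1..?n. (vs ! (j - 1)) $ qubit ?n (i mod 2 ^ ?n) j)"
    using Cons by simp
  also have "\<dots> = (\<Prod>j=1..?n. ((v # vs) ! (Suc j - 1)) $ qubit (Suc ?n) i (Suc j))"
    by (rule prod.cong) (use bit in \<open>auto simp: nth_Cons'\<close>)
  also have "\<dots> = (\<Prod>j=Suc 1..Suc ?n. ((v # vs) ! (j - 1)) $ qubit (Suc ?n) i j)"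
    by (rule prod.shift_bounds_cl_Suc_ivl[symmetric])
  also have "v $ (i div 2 ^ ?n) = ((v # vs) ! (1 - 1)) $ qubit (Suc ?n) i 1"
    using Cons.prems by (simp add: qubit_def less_mult_imp_div_less)
  finally show ?case
    by (simp only: prod.atLeast_Suc_atMost[of 1 "Suc ?n"] list.size add_Suc_right add_0_right)
qed


section \<open>Biseparability and witnesses\<close>

definition state_vec :: "nat \<Rightarrow> complex vec \<Rightarrow> bool" where
  "state_vec n v \<longleftrightarrow> v \<in> carrier_vec (2 ^ n) \<and> v \<bullet>c v = 1"

definition density :: "nat \<Rightarrow> complex mat \<Rightarrow> bool" where
  "density n \<rho> \<longleftrightarrow> \<rho> \<in> carrier_mat (2 ^ n) (2 ^ n) \<and> hermitian \<rho>
     \<and> (\<forall>v \<in> carrier_vec (2 ^ n). 0 \<le> Re (expectation \<rho> v)) \<and> trace \<rho> = 1"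

text \<open>\<open>v = a \<otimes> b\<close> with \<open>a\<close> a vector of the qubits in \<open>S\<close> and \<open>b\<close> one of the remaining qubits.
  A computational basis vector of a set of qubits is labelled by the subset of those having
  value 1; in this way \<open>S\<close> need not consist of consecutive qubits.
  The factors of a unit vector can be rescaled to unit vectors, so no norm is imposed on them.\<close>

definition product_across :: "nat \<Rightarrow> nat set \<Rightarrow> complex vec \<Rightarrow> bool" where
  "product_across n S v \<longleftrightarrow>
     (\<exists>a b :: nat set \<Rightarrow> complex. \<forall>i < 2 ^ n. v $ i = a (ones n i \<inter> S) * b (ones n i - S))"

definition biseparable_vec :: "nat \<Rightarrow> complex vec \<Rightarrow> bool" where
  "biseparable_vec n v \<longleftrightarrow>
     state_vec n v \<and> (\<exists>S. S \<noteq> {} \<and> S \<subset> {1..n} \<and> product_across n S v)"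

definition biseparable_state :: "nat \<Rightarrow> complex mat \<Rightarrow> bool" where
  "biseparable_state n \<rho> \<longleftrightarrow>
     (\<exists>m (p :: nat \<Rightarrow> real) \<psi>.
        (\<forall>i<m. 0 \<le> p i \<and> biseparable_vec n (\<psi> i)) \<and> (\<Sum>i<m. p i) = 1
        \<and> \<rho> = mat_Sum (2 ^ n) (\<lambda>i. complex_of_real (p i) \<cdot>\<^sub>m ketbra (\<psi> i) (\<psi> i)) {..<m})"

definition gme_witness :: "nat \<Rightarrow> complex mat \<Rightarrow> bool" where
  "gme_witness n W \<longleftrightarrow> W \<in> carrier_mat (2 ^ n) (2 ^ n) \<and> hermitian W
     \<and> (\<forall>\<rho>. biseparable_state n \<rho> \<longrightarrow> 0 \<le> Re (trace (W * \<rho>)))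
     \<and> (\<exists>\<rho>. density n \<rho> \<and> Re (trace (W * \<rho>)) < 0)"


section \<open>The GHZ witness and its misaligned evaluation\<close>

definition ghz :: "nat \<Rightarrow> complex vec" where
  "ghz n = complex_of_real (1 / sqrt 2) \<cdot>\<^sub>v
     (tensor_vec (replicate n ket0) + tensor_vec (replicate n ket1))"

definition W_GHZ :: "nat \<Rightarrow> complex mat" where
  "W_GHZ n = (1 / 2) \<cdot>\<^sub>m 1\<^sub>m (2 ^ n) - ketbra (ghz n) (ghz n)"

definition xy_observable :: "real \<Rightarrow> complex mat" where
  "xy_observable \<theta> =
     complex_of_real (cos \<theta>) \<cdot>\<^sub>m sigma_x + complex_of_real (sin \<theta>) \<cdot>\<^sub>m sigma_y"

definition M_obs :: "nat \<Rightarrow> nat \<Rightarrow> nat \<Rightarrow> complex mat" where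
  "M_obs n k j = xy_observable (real k * pi / real n)"

definition N_obs :: "nat \<Rightarrow> real \<Rightarrow> nat \<Rightarrow> nat \<Rightarrow> complex mat" where
  "N_obs n \<epsilon> k j =
     (if j \<le> n div 2 then xy_observable (real k * pi / real n + (- 1) ^ k * \<epsilon>)
      else xy_observable (real k * pi / real n - (- 1) ^ k * \<epsilon>))"

text \<open>The local decomposition of the witness, evaluated with the observable \<open>A k j\<close>
  on qubit \<open>j\<close> in the \<open>k\<close>-th setting.\<close>

definition witness_decomposition :: "nat \<Rightarrow> (nat \<Rightarrow> nat \<Rightarrow> complex mat) \<Rightarrow> complex mat" where
  "witness_decomposition n A = (1 / 2) \<cdot>\<^sub>m
     (1\<^sub>m (2 ^ n)
      - mat_Sum (2 ^ n)
          (\<lambda>l. tensor_mat (replicate n ((1 / 2) \<cdot>\<^sub>m (1\<^sub>m 2 + l \<cdot>\<^sub>m sigma_z)))) {1, - 1}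
      - mat_Sum (2 ^ n)
          (\<lambda>k. ((- 1) ^ k / of_nat n) \<cdot>\<^sub>m tensor_mat (map (A k) [1..<n + 1])) {1..n})"

definition W_eps :: "nat \<Rightarrow> real \<Rightarrow> complex mat" where
  "W_eps n \<epsilon> = witness_decomposition n (N_obs n \<epsilon>)"

definition psi :: "nat \<Rightarrow> complex vec" where
  "psi n = (1 / 2) \<cdot>\<^sub>v kron_vec
     (tensor_vec (replicate (n div 2) ket0)
        + exp (\<i> * of_real pi / 4) \<cdot>\<^sub>v tensor_vec (replicate (n div 2) ket1))
     (tensor_vec (replicate (n div 2) ket0)
        + exp (- \<i> * of_real pi / 4) \<cdot>\<^sub>v tensor_vec (replicate (n div 2) ket1))"

end

theory Submission
  imports Defs
begin

text \<open>The sum over \<open>k\<close> in the decomposition of the witness is a sum over \<open>n\<close>-th roots of unity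
  which keeps only the two entries joining \<open>|0\<dots>0\<rangle>\<close> and \<open>|1\<dots>1\<rangle>\<close>.
  Up to normalization, the state \<open>\<psi>\<^sub>n\<close> is a product of \<open>|0\<dots>0\<rangle> + e\<^sup>i\<^sup>\<alpha>|1\<dots>1\<rangle>\<close> with
  \<open>\<alpha> = \<pi>/4\<close> and \<open>\<alpha> = - \<pi>/4\<close> on \<open>h = n/2\<close> qubits each. In such a factor, the \<open>h\<close>-fold tensor
  power of \<open>cos \<theta> \<sigma>\<^sub>x + sin \<theta> \<sigma>\<^sub>y\<close> has the expectation \<open>2 cos (h \<theta> - \<alpha>)\<close>. The product of the
  two cosines splits into a part depending on the mean angle, which the misalignment leaves unchanged,
  and a part depending on the difference of the angles, which turns the misalignment
  into \<open>sin n\<epsilon>\<close>.\<close>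

section \<open>Basis labels\<close>

text \<open>Passing to library bit operations avoids quotient arithmetic below. Qubit 1 is the most
  significant digit, hence the position \<open>n - j\<close>.\<close>

lemma qubit_bit: "qubit n i j = of_bool (bit i (n - j))"
  by (simp add: qubit_def bit_iff_odd odd_iff_mod_2_eq_one)

lemma mem_ones_iff: "j \<in> ones n i \<longleftrightarrow> 1 \<le> j \<and> j \<le> n \<and> bit i (n - j)"
  by (auto simp: ones_def qubit_bit)

lemma ones_subset: "ones n i \<subseteq> {1..n}"
  by (auto simp: ones_def)

lemma bit_imp_less: "bit (i::nat) m \<Longrightarrow> i < 2 ^ n \<Longrightarrow> m < n"
  by (metis bit_take_bit_iff take_bit_nat_eq_self)

text \<open>Below \<open>2 ^ n\<close> all digits at positions from \<open>n\<close> on vanish, and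
  the digit at a position \<open>m < n\<close> is read off at qubit \<open>n - m\<close>.\<close>

lemma ones_inj:
  assumes "i < 2 ^ n" "i' < 2 ^ n" "ones n i = ones n i'"
  shows "i = i'"
proof (rule bit_eqI)
  fix m
  have "m < n \<Longrightarrow> n - (n - m) = m \<and> 1 \<le> n - m \<and> n - m \<le> n" by linarith
  then show "bit i m = bit i' m"
    using assms(3) mem_ones_iff[of "n - m" n i] mem_ones_iff[of "n - m" n i']
      bit_imp_less[OF _ assms(1)] bit_imp_less[OF _ assms(2)] by metis
qed

lemma ones_surj:
  assumes "S \<subseteq> {1..n}"
  obtains i where "i < 2 ^ n" "ones n i = S"
proof
  \<comment> \<open>The Horner sum prescribes the binary digits, position \<open>m\<close> belonging
    to qubit \<open>n - m\<close>; the truncation makes the bound immediate.\<close>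
  let ?i = "take_bit n (horner_sum of_bool 2 (map (\<lambda>m. n - m \<in> S) [0..<n])) :: nat"
  show "?i < 2 ^ n" by simp
  show "ones n ?i = S"
    using assms by (auto simp: mem_ones_iff bit_take_bit_iff bit_horner_sum_bit_iff)
qed

lemma ones_0 [simp]: "ones n 0 = {}"
  by (auto simp: mem_ones_iff)

lemma ones_mask: "ones n (2 ^ n - 1) = {1..n}"
  by (auto simp: mem_ones_iff bit_mask_iff simp flip: mask_eq_exp_minus_1 simp del: One_nat_def)

lemma ones_eq_empty_iff: "i < 2 ^ n \<Longrightarrow> ones n i = {} \<longleftrightarrow> i = 0"
  using ones_inj[of i n 0] by auto

lemma ones_eq_all_iff: "i < 2 ^ n \<Longrightarrow> ones n i = {1..n} \<longleftrightarrow> i = 2 ^ n - 1"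
  using ones_inj[of i n "2 ^ n - 1"] ones_mask[of n] by (simp del: One_nat_def) blast

text \<open>Cutting \<open>h + m\<close> qubits in two: the quotient keeps the first
  \<open>h\<close> qubits under their own numbers, whereas the remainder, treated next, keeps the
  last \<open>m\<close> with numbers shifted by \<open>h\<close>.\<close>

lemma ones_div: "ones h (i div 2 ^ m) = ones (h + m) i \<inter> {1..h}"
  by (auto simp: mem_ones_iff bit_iff_odd add.commute simp flip: div_mult2_eq power_add)

lemma ones_mod: "j \<in> ones m (i mod 2 ^ m) \<longleftrightarrow> 1 \<le> j \<and> j + h \<in> ones (h + m) i"
  by (auto simp: mem_ones_iff bit_take_bit_iff simp flip: take_bit_eq_mod)

section \<open>Tensor products\<close>

lemma dim_tensor_mat:
  assumes "\<forall>A\<in>set As. A \<in> carrier_mat 2 2"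
  shows "tensor_mat As \<in> carrier_mat (2 ^ length As) (2 ^ length As)"
  using assms by (induction As) (auto simp: tensor_mat_def kron_mat_def)

text \<open>Same induction as for \<open>tensor_vec_index\<close>: the first factor reads the
  leading digit of both indices, and the tail reads the rest.\<close>

lemma tensor_mat_index:
  assumes "\<forall>A\<in>set As. A \<in> carrier_mat 2 2" and "r < 2 ^ length As" and "c < 2 ^ length As"
  shows "tensor_mat As $$ (r, c) =
    (\<Prod>j=1..length As. (As ! (j - 1)) $$ (qubit (length As) r j, qubit (length As) c j))"
  using assms
proof (induction As arbitrary: r c)
  case Nil
  then show ?case by (simp add: tensor_mat_def)
next
  case (Cons A As)
  let ?n = "length As"
  have bit: "qubit ?n (i mod 2 ^ ?n) j = qubit (Suc ?n) i (Suc j)" if "j \<in> {1..?n}" for i j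
    using that by (auto simp: qubit_bit bit_take_bit_iff simp flip: take_bit_eq_mod)
  have "tensor_mat As \<in> carrier_mat (2 ^ ?n) (2 ^ ?n)" "dim_row A = 2" "dim_col A = 2"
    using Cons.prems dim_tensor_mat by auto
  then have "tensor_mat (A # As) $$ (r, c)
      = A $$ (r div 2 ^ ?n, c div 2 ^ ?n) * tensor_mat As $$ (r mod 2 ^ ?n, c mod 2 ^ ?n)"
    using Cons.prems by (simp add: tensor_mat_def kron_mat_def)
  also have "tensor_mat As $$ (r mod 2 ^ ?n, c mod 2 ^ ?n)
      = (\<Prod>j=1..?n. (As ! (j - 1)) $$ (qubit ?n (r mod 2 ^ ?n) j, qubit ?n (c mod 2 ^ ?n) j))"
    using Cons by simp
  also have "\<dots> = (\<Prod>j=1..?n. ((A # As) ! (Suc j - 1)) $$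
      (qubit (Suc ?n) r (Suc j), qubit (Suc ?n) c (Suc j)))"
    by (rule prod.cong) (use bit in \<open>auto simp: nth_Cons'\<close>)
  also have "\<dots> = (\<Prod>j=Suc 1..Suc ?n. ((A # As) ! (j - 1)) $$
      (qubit (Suc ?n) r j, qubit (Suc ?n) c j))"
    by (rule prod.shift_bounds_cl_Suc_ivl[symmetric])
  also have "A $$ (r div 2 ^ ?n, c div 2 ^ ?n)
      = ((A # As) ! (1 - 1)) $$ (qubit (Suc ?n) r 1, qubit (Suc ?n) c 1)"
    using Cons.prems by (simp add: qubit_def less_mult_imp_div_less)
  finally show ?case
    by (simp only: prod.atLeast_Suc_atMost[of 1 "Suc ?n"] list.size add_Suc_right add_0_right)
qed

lemma kron_mat_carrier [simp]:
  "A \<in> carrier_mat p q \<Longrightarrow> B \<in> carrier_mat p' q' \<Longrightarrow> kron_mat A B \<in> carrier_mat (p * p') (q * q')"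
  by (auto simp: kron_mat_def)

text \<open>Division with remainder is a bijection onto pairs with inverse \<open>a * q + b\<close>,
  so a sum over a Kronecker index becomes an iterated sum.\<close>

lemma sum_div_mod:
  fixes f :: "nat \<Rightarrow> nat \<Rightarrow> 'a::comm_monoid_add"
  shows "(\<Sum>i<p * q. f (i div q) (i mod q)) = (\<Sum>a<p. \<Sum>b<q. f a b)"
proof -
  have lt: "a * q + b < p * q" if "a < p" "b < q" for a b
  proof -
    have "a * q + b < Suc a * q" using that by simp
    also have "\<dots> \<le> p * q" using that by (intro mult_le_mono1) simp
    finally show ?thesis .
  qed
  have "(\<Sum>a<p. \<Sum>b<q. f a b) = (\<Sum>(a, b)\<in>{..<p} \<times> {..<q}. f a b)"
    by (simp add: sum.cartesian_product)
  also have "\<dots> = (\<Sum>i<p * q. f (i div q) (i mod q))"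
    by (rule sum.reindex_bij_witness[of _ "\<lambda>i. (i div q, i mod q)" "\<lambda>(a, b). a * q + b"])
      (auto simp: lt less_mult_imp_div_less intro!: mod_less_divisor,
       metis gr0I less_nat_zero_code mult_0_right)
  finally show ?thesis by simp
qed

text \<open>Both bracketings read the same three mixed-radix digits from each index; the facts
  \<open>m\<close> convert one nesting of quotients and remainders into the other.\<close>

lemma kron_mat_assoc: "kron_mat (kron_mat A B) C = kron_mat A (kron_mat B C)"
proof (rule eq_matI)
  fix r c
  assume rc: "r < dim_row (kron_mat A (kron_mat B C))" "c < dim_col (kron_mat A (kron_mat B C))"
  have *: "r div k < a * b" "r mod (b * k) < b * k"
    if "r < a * (b * k)" for r a b k :: nat
    using that by (auto simp: less_mult_imp_div_less mult.assoc intro!: mod_less_divisor gr0I)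
  have m: "x mod (b * k) mod k = x mod k" "x mod (b * k) div k = x div k mod b"
    "x div (b * k) = x div k div b" for x b k :: nat
    by (cases "k = 0"; simp add: mod_mod_cancel mod_mult2_eq mult.commute[of b k] div_mult2_eq)+
  have "dim_row C > 0" "dim_col C > 0" using rc by (auto simp: kron_mat_def intro!: gr0I)
  then show "kron_mat (kron_mat A B) C $$ (r, c) = kron_mat A (kron_mat B C) $$ (r, c)"
    using rc *[of r "dim_row A" "dim_row B" "dim_row C"] *[of c "dim_col A" "dim_col B" "dim_col C"]
    by (simp add: kron_mat_def m mult.assoc)
qed (auto simp: kron_mat_def)

lemma tensor_mat_append: "tensor_mat (As @ Bs) = kron_mat (tensor_mat As) (tensor_mat Bs)"
proof (induction As)
  case Nil
  show ?case by (rule eq_matI) (auto simp: tensor_mat_def kron_mat_def)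
next
  case (Cons A As)
  then show ?case by (simp add: tensor_mat_def kron_mat_assoc)
qed

section \<open>Expectation values\<close>

lemma expectation_eq_sum:
  assumes "A \<in> carrier_mat d d" "v \<in> carrier_vec d"
  shows "expectation A v = (\<Sum>r<d. \<Sum>c<d. A $$ (r, c) * v $ c * cnj (v $ r))"
  using assms
  by (auto simp: expectation_def scalar_prod_def atLeast0LessThan sum_distrib_right
      intro!: sum.cong)

lemma inner_eq_sum:
  fixes v :: "complex vec"
  assumes "v \<in> carrier_vec d"
  shows "v \<bullet>c v = (\<Sum>r<d. v $ r * cnj (v $ r))"
  using assms by (auto simp: scalar_prod_def atLeast0LessThan)

lemma expectation_one: "v \<in> carrier_vec d \<Longrightarrow> expectation (1\<^sub>m d) v = v \<bullet>c v"
  by (simp add: expectation_def)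

lemma expectation_minus:
  "A \<in> carrier_mat d d \<Longrightarrow> B \<in> carrier_mat d d \<Longrightarrow> v \<in> carrier_vec d \<Longrightarrow>
    expectation (A - B) v = expectation A v - expectation B v"
  by (simp add: expectation_eq_sum[of _ d] minus_carrier_mat algebra_simps sum_subtractf)

lemma expectation_smult:
  "A \<in> carrier_mat d d \<Longrightarrow> v \<in> carrier_vec d \<Longrightarrow>
    expectation (x \<cdot>\<^sub>m A) v = x * expectation A v"
  by (simp add: expectation_eq_sum[of _ d] sum_distrib_left mult.assoc)

lemma expectation_smult_vec:
  "A \<in> carrier_mat d d \<Longrightarrow> v \<in> carrier_vec d \<Longrightarrow>
    expectation A (x \<cdot>\<^sub>v v) = x * cnj x * expectation A v"
  by (subst (1 2) expectation_eq_sum[of _ d])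
    (auto simp: sum_distrib_left intro!: sum.cong)

lemma mat_Sum_carrier [simp]: "mat_Sum d F I \<in> carrier_mat d d"
  by (simp add: mat_Sum_def)

lemma expectation_mat_Sum:
  assumes "\<And>i. i \<in> I \<Longrightarrow> F i \<in> carrier_mat d d" "v \<in> carrier_vec d"
  shows "expectation (mat_Sum d F I) v = (\<Sum>i\<in>I. expectation (F i) v)"
proof -
  have "expectation (mat_Sum d F I) v
      = (\<Sum>r<d. \<Sum>c<d. \<Sum>i\<in>I. F i $$ (r, c) * v $ c * cnj (v $ r))"
    using assms by (simp add: expectation_eq_sum[of _ d] mat_Sum_def sum_distrib_right)
  also have "\<dots> = (\<Sum>r<d. \<Sum>i\<in>I. \<Sum>c<d. F i $$ (r, c) * v $ c * cnj (v $ r))"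
    by (intro sum.cong refl sum.swap)
  also have "\<dots> = (\<Sum>i\<in>I. \<Sum>r<d. \<Sum>c<d. F i $$ (r, c) * v $ c * cnj (v $ r))"
    by (rule sum.swap)
  also have "\<dots> = (\<Sum>i\<in>I. expectation (F i) v)"
    using assms by (simp add: expectation_eq_sum[of _ d])
  finally show ?thesis .
qed

section \<open>Factorization over Kronecker products\<close>

lemma kron_vec_carrier [simp]:
  "u \<in> carrier_vec p \<Longrightarrow> w \<in> carrier_vec q \<Longrightarrow> kron_vec u w \<in> carrier_vec (p * q)"
  by (intro carrier_vecI) (simp add: kron_vec_def)

lemma inner_kron:
  assumes "u \<in> carrier_vec p" "w \<in> carrier_vec q"
  shows "kron_vec u w \<bullet>c kron_vec u w = (u \<bullet>c u) * (w \<bullet>c w)"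
proof -
  have "kron_vec u w \<bullet>c kron_vec u w
      = (\<Sum>i<p * q. (u $ (i div q) * w $ (i mod q)) * cnj (u $ (i div q) * w $ (i mod q)))"
    using assms by (subst inner_eq_sum[of _ "p * q"]) (auto simp: kron_vec_def)
  also have "\<dots> = (\<Sum>a<p. \<Sum>b<q. (u $ a * w $ b) * cnj (u $ a * w $ b))"
    by (rule sum_div_mod)
  also have "\<dots> = (u \<bullet>c u) * (w \<bullet>c w)"
    using assms by (simp add: inner_eq_sum sum_product mult_ac)
  finally show ?thesis .
qed

text \<open>Every entry splits into a factor depending on the quotients and one depending on the
  remainders of the indices, so the fourfold sum separates.\<close>

lemma expectation_kron:
  assumes A: "A \<in> carrier_mat p p" "u \<in> carrier_vec p"
    and B: "B \<in> carrier_mat q q" "w \<in> carrier_vec q"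
  shows "expectation (kron_mat A B) (kron_vec u w) = expectation A u * expectation B w"
proof -
  let ?f = "\<lambda>a a'. A $$ (a, a') * u $ a' * cnj (u $ a)"
  let ?g = "\<lambda>b b'. B $$ (b, b') * w $ b' * cnj (w $ b)"
  have "expectation (kron_mat A B) (kron_vec u w)
      = (\<Sum>r<p * q. \<Sum>c<p * q. ?f (r div q) (c div q) * ?g (r mod q) (c mod q))"
    using assms
    by (subst expectation_eq_sum[of _ "p * q"])
      (auto simp: kron_mat_def kron_vec_def mult_ac intro!: sum.cong)
  also have "\<dots> = (\<Sum>r<p * q. \<Sum>a'<p. \<Sum>b'<q. ?f (r div q) a' * ?g (r mod q) b')"
    by (intro sum.cong refl sum_div_mod)
  also have "\<dots> = (\<Sum>a<p. \<Sum>b<q. \<Sum>a'<p. \<Sum>b'<q. ?f a a' * ?g b b')"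
    by (rule sum_div_mod)
  also have "\<dots> = (\<Sum>a<p. \<Sum>b<q. (\<Sum>a'<p. ?f a a') * (\<Sum>b'<q. ?g b b'))"
    by (simp only: sum_product)
  also have "\<dots> = expectation A u * expectation B w"
    using assms by (simp only: expectation_eq_sum sum_product)
  finally show ?thesis .
qed

section \<open>Traces against pure and mixed states\<close>

lemma ketbra_carrier [simp]: "v \<in> carrier_vec p \<Longrightarrow> w \<in> carrier_vec q \<Longrightarrow> ketbra v w \<in> carrier_mat p q"
  by (auto simp: ketbra_def)

lemma trace_mult_ketbra:
  assumes "A \<in> carrier_mat d d" "v \<in> carrier_vec d"
  shows "trace (A * ketbra v v) = expectation A v"
  using assms
  by (auto simp: trace_def expectation_eq_sum[of _ d] ketbra_def scalar_prod_def
      atLeast0LessThan mult.assoc intro!: sum.cong)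

text \<open>By linearity the value on a mixture is the weighted sum of the pure-state expectations;
  this reduces the witness condition to pure biseparable vectors.\<close>

lemma trace_mult_mat_Sum:
  assumes A: "A \<in> carrier_mat d d" and v: "\<And>i. i \<in> I \<Longrightarrow> v i \<in> carrier_vec d"
  shows "trace (A * mat_Sum d (\<lambda>i. x i \<cdot>\<^sub>m ketbra (v i) (v i)) I)
    = (\<Sum>i\<in>I. x i * expectation A (v i))"
proof -
  have "trace (A * mat_Sum d (\<lambda>i. x i \<cdot>\<^sub>m ketbra (v i) (v i)) I)
      = (\<Sum>r<d. \<Sum>c<d. \<Sum>i\<in>I. x i * (A $$ (r, c) * v i $ c * cnj (v i $ r)))"
    using A carrier_vecD[OF v]
    by (auto simp: trace_def mat_Sum_def ketbra_def scalar_prod_def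
      atLeast0LessThan sum_distrib_left mult_ac intro!: sum.cong)
  also have "\<dots> = (\<Sum>r<d. \<Sum>i\<in>I. \<Sum>c<d. x i * (A $$ (r, c) * v i $ c * cnj (v i $ r)))"
    by (intro sum.cong refl sum.swap)
  also have "\<dots> = (\<Sum>i\<in>I. \<Sum>r<d. \<Sum>c<d. x i * (A $$ (r, c) * v i $ c * cnj (v i $ r)))"
    by (rule sum.swap)
  also have "\<dots> = (\<Sum>i\<in>I. x i * expectation A (v i))"
    using A v by (simp add: expectation_eq_sum[of _ d] sum_distrib_left)
  finally show ?thesis .
qed

lemma hermitian_iff:
  assumes "A \<in> carrier_mat d d"
  shows "hermitian A \<longleftrightarrow> (\<forall>r<d. \<forall>c<d. cnj (A $$ (c, r)) = A $$ (r, c))"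
proof -
  have "mat_adjoint A \<in> carrier_mat d d"
    and "r < d \<Longrightarrow> c < d \<Longrightarrow> mat_adjoint A $$ (r, c) = cnj (A $$ (c, r))" for r c
    using assms by (auto simp: mat_adjoint_def mat_of_rows_def)
  then show ?thesis
    using assms unfolding hermitian_def by (subst mat_eq_iff) auto
qed

section \<open>Superpositions of the all-zero and all-one states\<close>

text \<open>Common form of \<open>ghz n\<close> (with \<open>z = 1\<close>) and of both factors of
  \<open>psi n\<close>. It is left unnormalized, so that prefactors are handled only once.\<close>

definition cat_vec :: "nat \<Rightarrow> complex \<Rightarrow> complex vec" where
  "cat_vec n z = tensor_vec (replicate n ket0) + z \<cdot>\<^sub>v tensor_vec (replicate n ket1)"

lemma tensor_ket_carrier:
  "tensor_vec (replicate n ket0) \<in> carrier_vec (2 ^ n)"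
  "tensor_vec (replicate n ket1) \<in> carrier_vec (2 ^ n)"
  by (auto intro!: carrier_vecI simp: dim_tensor_vec ket0_def ket1_def)

lemma tensor_ket_index:
  assumes "i < 2 ^ n"
  shows "tensor_vec (replicate n ket0) $ i = of_bool (ones n i = {})" (is ?zero)
    and "tensor_vec (replicate n ket1) $ i = of_bool (ones n i = {1..n})" (is ?one)
proof -
  have k: "ket0 $ qubit n i j = of_bool (j \<notin> ones n i)" "ket1 $ qubit n i j = of_bool (j \<in> ones n i)"
    if "j \<in> {1..n}" for j
    using that by (auto simp: ket0_def ket1_def ones_def qubit_bit)
  have "tensor_vec (replicate n ket0) $ i = (\<Prod>j=1..n. of_bool (j \<notin> ones n i))"
    using assms k by (subst tensor_vec_index) (auto simp: ket0_def intro!: prod.cong)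
  also have "\<dots> = of_bool (ones n i = {})"
    using ones_subset[of n i] by (cases "ones n i = {}") (auto intro!: prod_zero)
  finally show ?zero .
  have "tensor_vec (replicate n ket1) $ i = (\<Prod>j=1..n. of_bool (j \<in> ones n i))"
    using assms k by (subst tensor_vec_index) (auto simp: ket1_def intro!: prod.cong)
  also have "\<dots> = of_bool (ones n i = {1..n})"
    using ones_subset[of n i] by (cases "ones n i = {1..n}") (auto intro!: prod_zero)
  finally show ?one .
qed

lemma cat_vec_carrier [simp]: "cat_vec n z \<in> carrier_vec (2 ^ n)"
  by (simp add: cat_vec_def tensor_ket_carrier)

lemma dim_cat_vec [simp]: "dim_vec (cat_vec n z) = 2 ^ n"
  by (rule carrier_vecD[OF cat_vec_carrier])

lemma cat_vec_index:
  assumes "i < 2 ^ n"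
  shows "cat_vec n z $ i = of_bool (ones n i = {}) + z * of_bool (ones n i = {1..n})"
proof -
  have "dim_vec (tensor_vec (replicate n ket0)) = 2 ^ n" "dim_vec (tensor_vec (replicate n ket1)) = 2 ^ n"
    using tensor_ket_carrier[of n] by auto
  then show ?thesis
    using assms tensor_ket_index[of i n] by (simp add: cat_vec_def)
qed

lemma cat_vec_index':
  assumes "i < 2 ^ n"
  shows "cat_vec n z $ i = of_bool (i = 0) + z * of_bool (i = 2 ^ n - 1)"
  using cat_vec_index[OF assms] ones_eq_empty_iff[OF assms] ones_eq_all_iff[OF assms] by simp

text \<open>Only the first and the last position carry weight. For \<open>n = 0\<close> they
  coincide and both contributions add up there.\<close>

lemma sum_mult_cat_vec:
  assumes "\<And>i. i < 2 ^ n \<Longrightarrow> v i = cat_vec n z $ i"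
  shows "(\<Sum>i<2 ^ n. f i * v i) = f 0 + z * f (2 ^ n - 1)"
    and "(\<Sum>i<2 ^ n. f i * cnj (v i)) = f 0 + cnj z * f (2 ^ n - 1)"
proof -
  have *: "(\<Sum>i<2 ^ n. f i * (of_bool (i = 0) + w * of_bool (i = 2 ^ n - 1))) = f 0 + w * f (2 ^ n - 1)" for w
    by (simp add: algebra_simps sum.distrib flip: sum_distrib_left)
  show "(\<Sum>i<2 ^ n. f i * v i) = f 0 + z * f (2 ^ n - 1)"
    unfolding *[symmetric] using assms by (intro sum.cong) (auto simp: cat_vec_index')
  show "(\<Sum>i<2 ^ n. f i * cnj (v i)) = f 0 + cnj z * f (2 ^ n - 1)"
    unfolding *[symmetric] using assms by (intro sum.cong) (auto simp: cat_vec_index')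
qed

text \<open>Only the four corner entries of the matrix meet the support of the vector; all later
  expectation values in such vectors are read off from them.\<close>

lemma expectation_cat_vec:
  assumes "A \<in> carrier_mat (2 ^ n) (2 ^ n)"
  shows "expectation A (cat_vec n z) = A $$ (0, 0) + z * A $$ (0, 2 ^ n - 1)
    + cnj z * (A $$ (2 ^ n - 1, 0) + z * A $$ (2 ^ n - 1, 2 ^ n - 1))"
proof -
  have "expectation A (cat_vec n z)
      = (\<Sum>r<2 ^ n. (\<Sum>c<2 ^ n. A $$ (r, c) * cat_vec n z $ c) * cnj (cat_vec n z $ r))"
    using assms by (simp add: expectation_eq_sum[of _ "2 ^ n"] sum_distrib_right)
  then show ?thesis by (simp only: sum_mult_cat_vec)
qed

lemma inner_cat_vec:
  assumes "0 < n" "cmod z = 1"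
  shows "cat_vec n z \<bullet>c cat_vec n z = 2"
proof -
  \<comment> \<open>With at least one qubit the two basis positions differ, so the cross terms of
    the squared norm vanish.\<close>
  have "(2::nat) ^ n - 1 \<noteq> 0" using assms by (metis One_nat_def Suc_pred nat_power_eq_Suc_0_iff numeral_2_eq_2 n_not_Suc_n less_not_refl zero_less_power pos2)
  moreover have "z * cnj z = 1" using assms complex_norm_square[of z] by simp
  ultimately show ?thesis
    using expectation_cat_vec[of "1\<^sub>m (2 ^ n)" n z]
    by (simp add: expectation_one mult.commute)
qed

section \<open>Product observables\<close>

lemma xy_observable_carrier [simp]: "xy_observable \<theta> \<in> carrier_mat 2 2"
  by (intro carrier_matI) (simp_all add: xy_observable_def sigma_x_def sigma_y_def mat_of_rows_list_def)

lemma xy_observable_index: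
  assumes "a < 2" "b < 2"
  shows "xy_observable \<theta> $$ (a, b) = (if a = b then 0 else if a = 0 then cis (- \<theta>) else cis \<theta>)"
proof -
  have "a = 0 \<or> a = 1" "b = 0 \<or> b = 1" using assms by auto
  then show ?thesis
    by (auto simp: xy_observable_def sigma_x_def sigma_y_def mat_of_rows_list_def complex_eq_iff)
qed

text \<open>Every factor flips its qubit, so row and column labels must be complementary. A row
  digit 1 contributes the phase \<theta> and a row digit 0 the phase -\<theta>; the total counts
  ones minus zeros.\<close>

lemma tensor_xy_index:
  assumes "r < 2 ^ n" "c < 2 ^ n"
  shows "tensor_mat (replicate n (xy_observable \<theta>)) $$ (r, c) =
    of_bool (ones n c = {1..n} - ones n r) * cis ((2 * real (card (ones n r)) - real n) * \<theta>)"
proof -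
  have "tensor_mat (replicate n (xy_observable \<theta>)) $$ (r, c) =
      (\<Prod>j=1..n. xy_observable \<theta> $$ (qubit n r j, qubit n c j))"
    using assms by (subst tensor_mat_index) (auto intro!: prod.cong)
  also have "\<dots> = (\<Prod>j=1..n. of_bool (j \<in> ones n c \<longleftrightarrow> j \<notin> ones n r) * (if j \<in> ones n r then cis \<theta> else cis (- \<theta>)))"
    by (intro prod.cong refl, subst xy_observable_index) (auto simp: ones_def qubit_bit)
  also have "\<dots> = (\<Prod>j=1..n. of_bool (j \<in> ones n c \<longleftrightarrow> j \<notin> ones n r)) *
      (\<Prod>j=1..n. if j \<in> ones n r then cis \<theta> else cis (- \<theta>))"
    by (rule prod.distrib)
  also have "(\<Prod>j=1..n. of_bool (j \<in> ones n c \<longleftrightarrow> j \<notin> ones n r))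
      = (of_bool (ones n c = {1..n} - ones n r) :: complex)"
  proof (cases "ones n c = {1..n} - ones n r")
    case True
    then show ?thesis by (auto intro!: prod.neutral)
  next
    case False
    then obtain j where "j \<in> {1..n}" "\<not> (j \<in> ones n c \<longleftrightarrow> j \<notin> ones n r)"
      using ones_subset[of n c] by blast
    then show ?thesis using False by (auto intro!: prod_zero)
  qed
  also have "(\<Prod>j=1..n. if j \<in> ones n r then cis \<theta> else cis (- \<theta>))
      = cis \<theta> ^ card (ones n r) * cis (- \<theta>) ^ (n - card (ones n r))"
  proof -
    have "{1..n} \<inter> ones n r = ones n r" "{1..n} \<inter> - ones n r = {1..n} - ones n r"
      using ones_subset[of n r] by auto
    then show ?thesis
      using ones_subset[of n r] by (simp add: prod.If_cases card_Diff_subset finite_subset)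
  qed
  also have "\<dots> = cis ((2 * real (card (ones n r)) - real n) * \<theta>)"
  proof -
    have "card (ones n r) \<le> n" using card_mono[OF _ ones_subset[of n r]] by simp
    then show ?thesis
      by (simp add: DeMoivre cis_mult of_nat_diff algebra_simps)
  qed
  finally show ?thesis .
qed

text \<open>The diagonal corners vanish because the observable flips all qubits; the other two carry
  opposite phases and give complex conjugate terms.\<close>

lemma expectation_xy_cat:
  assumes "0 < n"
  shows "expectation (tensor_mat (replicate n (xy_observable \<theta>))) (cat_vec n (cis \<alpha>))
    = of_real (2 * cos (real n * \<theta> - \<alpha>))"
proof -
  have "expectation (tensor_mat (replicate n (xy_observable \<theta>))) (cat_vec n (cis \<alpha>))
      = cis \<alpha> * cis (- (real n * \<theta>)) + cis (- \<alpha>) * cis (real n * \<theta>)"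
    using assms dim_tensor_mat[of "replicate n (xy_observable \<theta>)"] ones_mask[of n]
    by (subst expectation_cat_vec) (auto simp: tensor_xy_index cis_cnj simp del: One_nat_def)
  also have "\<dots> = of_real (2 * cos (real n * \<theta> - \<alpha>))"
    by (simp add: cis_mult complex_eq_iff sin_diff cos_diff sin_add cos_add)
  finally show ?thesis .
qed

section \<open>The sigma_z setting\<close>

text \<open>Written literally as in \<open>witness_decomposition\<close>, so that it can be folded
  there; it is a projector for the eigenvalues \<open>l = 1\<close> and
  \<open>l = - 1\<close>.\<close>

definition z_projector :: "complex \<Rightarrow> complex mat" where
  "z_projector l = (1 / 2) \<cdot>\<^sub>m (1\<^sub>m 2 + l \<cdot>\<^sub>m sigma_z)"

lemma z_projector_carrier [simp]: "z_projector l \<in> carrier_mat 2 2"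
  by (intro carrier_matI) (simp_all add: z_projector_def sigma_z_def mat_of_rows_list_def)

lemma z_projector_index:
  assumes "a < 2" "b < 2"
  shows "z_projector 1 $$ (a, b) = of_bool (a = 0 \<and> b = 0)"
    and "z_projector (- 1) $$ (a, b) = of_bool (a = 1 \<and> b = 1)"
proof -
  have "a = 0 \<or> a = 1" "b = 0 \<or> b = 1" using assms by auto
  then show "z_projector 1 $$ (a, b) = of_bool (a = 0 \<and> b = 0)"
    and "z_projector (- 1) $$ (a, b) = of_bool (a = 1 \<and> b = 1)"
    by (auto simp: z_projector_def sigma_z_def mat_of_rows_list_def)
qed

lemma tensor_z_projector_index:
  assumes "r < 2 ^ n" "c < 2 ^ n"
  shows "tensor_mat (replicate n (z_projector 1)) $$ (r, c) = of_bool (ones n r = {} \<and> ones n c = {})"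
      (is ?plus)
    and "tensor_mat (replicate n (z_projector (- 1))) $$ (r, c)
      = of_bool (ones n r = {1..n} \<and> ones n c = {1..n})" (is ?minus)
proof -
  have "tensor_mat (replicate n (z_projector 1)) $$ (r, c)
      = (\<Prod>j=1..n. of_bool (j \<notin> ones n r \<and> j \<notin> ones n c))"
    using assms
    by (subst tensor_mat_index) (auto simp: z_projector_index ones_def qubit_bit intro!: prod.cong)
  also have "\<dots> = of_bool (ones n r = {} \<and> ones n c = {})"
    using ones_subset[of n r] ones_subset[of n c]
    by (cases "ones n r = {} \<and> ones n c = {}") (auto intro!: prod_zero)
  finally show ?plus .
  have "tensor_mat (replicate n (z_projector (- 1))) $$ (r, c)
      = (\<Prod>j=1..n. of_bool (j \<in> ones n r \<and> j \<in> ones n c))"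
    using assms
    by (subst tensor_mat_index) (auto simp: z_projector_index ones_def qubit_bit intro!: prod.cong)
  also have "\<dots> = of_bool (ones n r = {1..n} \<and> ones n c = {1..n})"
    using ones_subset[of n r] ones_subset[of n c]
    by (cases "ones n r = {1..n} \<and> ones n c = {1..n}") (auto intro!: prod_zero)
  finally show ?minus .
qed

text \<open>Each of the two projectors retains one diagonal corner, of weight 1 or
  \<open>z * cnj z = 1\<close>.\<close>

lemma expectation_z_projector_cat:
  assumes "0 < n" "cmod z = 1" "l \<in> {1, - 1}"
  shows "expectation (tensor_mat (replicate n (z_projector l))) (cat_vec n z) = 1"
proof -
  have "cnj z * z = 1" using assms complex_norm_square[of z] by (simp add: mult.commute)
  then show ?thesis
    using assms dim_tensor_mat[of "replicate n (z_projector l)"] ones_mask[of n]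
    by (subst expectation_cat_vec) (auto simp: tensor_z_projector_index simp del: One_nat_def)
qed

section \<open>The GHZ witness\<close>

lemma ghz_eq_cat_vec: "ghz n = complex_of_real (1 / sqrt 2) \<cdot>\<^sub>v cat_vec n 1"
  by (simp add: ghz_def cat_vec_def)

lemma ghz_carrier [simp]: "ghz n \<in> carrier_vec (2 ^ n)"
  by (simp add: ghz_eq_cat_vec)

lemma dim_ghz [simp]: "dim_vec (ghz n) = 2 ^ n"
  by (rule carrier_vecD[OF ghz_carrier])

lemma state_vec_ghz:
  assumes "0 < n"
  shows "state_vec n (ghz n)"
proof -
  have "complex_of_real (1 / sqrt 2) * cnj (complex_of_real (1 / sqrt 2)) = 1 / 2"
    by (simp flip: of_real_mult)
  then have "ghz n \<bullet>c ghz n = 1"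
    using assms expectation_smult_vec[of "1\<^sub>m (2 ^ n)" "2 ^ n" "cat_vec n 1" "complex_of_real (1 / sqrt 2)"]
    by (simp add: ghz_eq_cat_vec expectation_one inner_cat_vec smult_carrier_vec)
  then show ?thesis by (simp add: state_vec_def)
qed

lemma expectation_ketbra:
  assumes "g \<in> carrier_vec d" "v \<in> carrier_vec d"
  shows "expectation (ketbra g g) v = of_real ((cmod (v \<bullet>c g))\<^sup>2)"
proof -
  have "expectation (ketbra g g) v
      = (\<Sum>r<d. \<Sum>c<d. (g $ r * cnj (v $ r)) * (v $ c * cnj (g $ c)))"
    using assms
    by (subst expectation_eq_sum[of _ d]) (auto simp: ketbra_def mult_ac intro!: sum.cong)
  also have "\<dots> = (\<Sum>c<d. v $ c * cnj (g $ c)) * cnj (\<Sum>r<d. v $ r * cnj (g $ r))"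
    unfolding sum_product[symmetric] by (simp add: mult.commute)
  also have "(\<Sum>c<d. v $ c * cnj (g $ c)) = v \<bullet>c g"
    using assms by (simp add: scalar_prod_def atLeast0LessThan)
  finally show ?thesis by (simp only: complex_norm_square)
qed

lemma inner_ghz:
  assumes "v \<in> carrier_vec (2 ^ n)"
  shows "v \<bullet>c ghz n = (v $ 0 + v $ (2 ^ n - 1)) / of_real (sqrt 2)"
proof -
  have "v \<bullet>c ghz n = (\<Sum>i<2 ^ n. (v $ i / of_real (sqrt 2)) * cnj (cat_vec n 1 $ i))"
    by (auto simp: scalar_prod_def ghz_eq_cat_vec atLeast0LessThan intro!: sum.cong)
  then show ?thesis
    by (simp only: sum_mult_cat_vec) (simp add: add_divide_distrib)
qed

lemma W_GHZ_carrier [simp]: "W_GHZ n \<in> carrier_mat (2 ^ n) (2 ^ n)"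
  by (simp add: W_GHZ_def minus_carrier_mat)

text \<open>Half the squared norm minus the squared overlap with \<open>ghz n\<close>. For unit
  vectors, nonnegativity thus amounts to the bound 1 on the squared modulus of the sum of the two
  extreme components.\<close>

lemma expectation_W_GHZ:
  assumes "v \<in> carrier_vec (2 ^ n)"
  shows "expectation (W_GHZ n) v
    = (v \<bullet>c v) / 2 - of_real ((cmod (v $ 0 + v $ (2 ^ n - 1)))\<^sup>2 / 2)"
proof -
  have "expectation (W_GHZ n) v = (1 / 2) * (v \<bullet>c v) - of_real ((cmod (v \<bullet>c ghz n))\<^sup>2)"
    unfolding W_GHZ_def using assms
    by (subst expectation_minus[of _ "2 ^ n"])
      (auto simp: expectation_smult[of _ "2 ^ n"] expectation_one expectation_ketbra[of _ "2 ^ n"])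
  then show ?thesis using assms by (simp add: inner_ghz norm_divide power_divide)
qed

lemma hermitian_ketbra: "hermitian (ketbra v v)"
  by (subst hermitian_iff[of _ "dim_vec v"]) (auto simp: ketbra_def)

lemma hermitian_W_GHZ: "hermitian (W_GHZ n)"
  by (subst hermitian_iff[OF W_GHZ_carrier]) (auto simp: W_GHZ_def ketbra_def)

lemma density_ketbra:
  assumes "state_vec n v"
  shows "density n (ketbra v v)"
proof -
  have v: "v \<in> carrier_vec (2 ^ n)" "v \<bullet>c v = 1" using assms by (auto simp: state_vec_def)
  have "trace (ketbra v v) = v \<bullet>c v"
    using v(1) by (simp add: inner_eq_sum trace_def ketbra_def)
  then show ?thesis
    using v by (auto simp: density_def hermitian_ketbra expectation_ketbra[of _ "2 ^ n"])
qed

text \<open>A product vector has \<open>v\<^sub>0 v\<^sub>N = v\<^sub>S v\<^sub>S'\<close>, where \<open>S\<close> and \<open>S'\<close> are the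
  basis labels of the two blocks, so that the cross term in \<open>|v\<^sub>0 + v\<^sub>N|\<^sup>2\<close> is paid for
  by two further components of \<open>v\<close>.\<close>

lemma biseparable_overlap:
  assumes "biseparable_vec n v"
  shows "(cmod (v $ 0 + v $ (2 ^ n - 1)))\<^sup>2 \<le> 1"
proof -
  from assms obtain S a b where v: "v \<in> carrier_vec (2 ^ n)" "v \<bullet>c v = 1"
    and S: "S \<noteq> {}" "S \<subset> {1..n}"
    and ab: "\<And>i. i < 2 ^ n \<Longrightarrow> v $ i = a (ones n i \<inter> S) * b (ones n i - S)"
    by (auto simp: biseparable_vec_def state_vec_def product_across_def)
  let ?N = "2 ^ n - 1 :: nat"
  have N: "?N < 2 ^ n" by simp
  obtain s where s: "s < 2 ^ n" "ones n s = S" using S ones_surj[of S n] by auto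
  obtain t where t: "t < 2 ^ n" "ones n t = {1..n} - S" using ones_surj[of "{1..n} - S" n] by auto
  define p q x y where "p = cmod (a {})" and "q = cmod (a S)"
    and "x = cmod (b {})" and "y = cmod (b ({1..n} - S))"
  have v0: "cmod (v $ 0) = p * x"
    by (simp add: ab p_def x_def norm_mult)
  have "{1..n} \<inter> S = S" using S by auto
  then have vN: "cmod (v $ ?N) = q * y"
    by (simp only: ab[OF N] ones_mask q_def y_def norm_mult)
  have vs: "cmod (v $ s) = q * x" using ab[OF s(1)] s(2) by (simp add: q_def x_def norm_mult)
  have "({1..n} - S) \<inter> S = {}" "{1..n} - S - S = {1..n} - S" by auto
  then have vt: "cmod (v $ t) = p * y"
    by (simp only: ab[OF t(1)] t(2) p_def y_def norm_mult)
  \<comment> \<open>The four positions are told apart by their labels: the empty set, all qubits,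
    \<open>S\<close> and its complement. This uses that \<open>S\<close> is nonempty and
    proper.\<close>
  have "distinct (map (ones n) [0, ?N, s, t])"
    unfolding list.map s(2) t(2) ones_mask ones_0 using S by auto
  then have dist: "distinct [0, ?N, s, t]" by (simp only: distinct_map)
  have "(\<Sum>i\<in>{0, ?N, s, t}. (cmod (v $ i))\<^sup>2) \<le> (\<Sum>i<2 ^ n. (cmod (v $ i))\<^sup>2)"
    using N s t by (intro sum_mono2) auto
  also have "complex_of_real \<dots> = 1"
    using v(2) inner_eq_sum[OF v(1)] by (simp only: of_real_sum complex_norm_square)
  then have "(\<Sum>i<2 ^ n. (cmod (v $ i))\<^sup>2) = 1" by (simp only: of_real_eq_1_iff)
  finally have le: "(p * x)\<^sup>2 + (q * y)\<^sup>2 + (q * x)\<^sup>2 + (p * y)\<^sup>2 \<le> 1"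
    using dist by (simp add: v0 vN vs vt del: One_nat_def)
  have "cmod (v $ 0 + v $ ?N) \<le> p * x + q * y"
    using norm_triangle_ineq[of "v $ 0" "v $ ?N"] v0 vN by simp
  then have "(cmod (v $ 0 + v $ ?N))\<^sup>2 \<le> (p * x + q * y)\<^sup>2"
    by (intro power_mono) auto
  \<comment> \<open>The cross term \<open>2 * (p * x) * (q * y)\<close> equals
    \<open>2 * (q * x) * (p * y)\<close>, and this is at most the sum of the last two
    squares.\<close>
  also have "\<dots> \<le> (p * x)\<^sup>2 + (q * y)\<^sup>2 + (q * x)\<^sup>2 + (p * y)\<^sup>2"
    using zero_le_power2[of "q * x - p * y"] by (simp add: power2_eq_square algebra_simps)
  also note le
  finally show ?thesis .
qed

text \<open>Nonnegativity passes from pure biseparable vectors to mixtures by linearity; the GHZ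
  state itself has the negative value 1/2 - 1.\<close>

lemma gme_witness_W_GHZ:
  assumes "0 < n"
  shows "gme_witness n (W_GHZ n)"
proof -
  have "0 \<le> Re (trace (W_GHZ n * \<rho>))" if "biseparable_state n \<rho>" for \<rho>
  proof -
    from that obtain m \<psi> and p :: "nat \<Rightarrow> real" where
      p: "\<And>i. i < m \<Longrightarrow> 0 \<le> p i" and bs: "\<And>i. i < m \<Longrightarrow> biseparable_vec n (\<psi> i)"
      and \<rho>: "\<rho> = mat_Sum (2 ^ n) (\<lambda>i. complex_of_real (p i) \<cdot>\<^sub>m ketbra (\<psi> i) (\<psi> i)) {..<m}"
      by (auto simp: biseparable_state_def)
    have st: "\<psi> i \<in> carrier_vec (2 ^ n)" "\<psi> i \<bullet>c \<psi> i = 1" if "i < m" for i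
      using bs[OF that] by (auto simp: biseparable_vec_def state_vec_def)
    have "trace (W_GHZ n * \<rho>) = (\<Sum>i<m. complex_of_real (p i) * expectation (W_GHZ n) (\<psi> i))"
      unfolding \<rho> using st by (intro trace_mult_mat_Sum) auto
    also have "Re \<dots> = (\<Sum>i<m. p i * Re (expectation (W_GHZ n) (\<psi> i)))"
      by simp
    also have "\<dots> \<ge> 0"
      using p bs st by (intro sum_nonneg mult_nonneg_nonneg)
        (auto simp: expectation_W_GHZ biseparable_overlap simp del: One_nat_def)
    finally show ?thesis .
  qed
  moreover have "Re (trace (W_GHZ n * ketbra (ghz n) (ghz n))) < 0"
  proof -
    have "ghz n \<bullet>c ghz n = 1" using state_vec_ghz[OF assms] by (simp add: state_vec_def)
    then have "expectation (W_GHZ n) (ghz n) = - 1 / 2"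
      unfolding W_GHZ_def
      by (subst expectation_minus[of _ "2 ^ n"])
        (auto simp: expectation_smult[of _ "2 ^ n"] expectation_one expectation_ketbra[of _ "2 ^ n"])
    then show ?thesis by (simp add: trace_mult_ketbra[of _ "2 ^ n"])
  qed
  ultimately show ?thesis
    using density_ketbra[OF state_vec_ghz[OF assms]]
    by (auto simp: gme_witness_def hermitian_W_GHZ)
qed

section \<open>Local decomposition of the GHZ witness\<close>

text \<open>A full geometric sum over powers of an \<open>n\<close>-th root of unity vanishes unless
  the root is 1. In the application \<open>a\<close> counts the ones of the row label.\<close>

lemma sum_cis_multiples:
  assumes "0 < n" "a \<le> n"
  shows "(\<Sum>k=1..n. cis (2 * pi * real a / real n) ^ k) = of_nat n * of_bool (a = 0 \<or> a = n)"
proof (cases "a = 0 \<or> a = n")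
  case True
  then show ?thesis using assms by (auto simp: cis_2pi)
next
  case False
  define w where "w = cis (2 * pi * real a / real n)"
  have "w ^ n = cis (2 * pi * real a)" using assms by (simp add: w_def DeMoivre)
  then have "w ^ n = 1" using cis_multiple_2pi[of "real a"] by (simp add: mult.assoc)
  \<comment> \<open>For \<open>0 < a < n\<close> half the angle of \<open>w\<close> lies strictly
    between 0 and \<pi>, which excludes \<open>w = 1\<close>.\<close>
  have "0 < sin (pi * real a / real n)"
    using False assms by (intro sin_gt_zero) (auto simp: field_simps)
  then have "cos (2 * (pi * real a / real n)) \<noteq> 1" unfolding cos_double_sin by simp
  then have "w \<noteq> 1" by (auto simp: w_def complex_eq_iff mult.assoc)
  have "(\<Sum>k=1..n. w ^ k) = w * (\<Sum>k<n. w ^ k)"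
    by (simp add: sum_distrib_left sum.atLeast1_atMost_eq)
  also have "\<dots> = 0"
    using \<open>w ^ n = 1\<close> \<open>w \<noteq> 1\<close> by (simp add: sum_gp_strict)
  finally show ?thesis using False by (simp add: w_def)
qed

lemma witness_decomposition_index:
  assumes "r < 2 ^ n" "c < 2 ^ n"
  shows "witness_decomposition n A $$ (r, c) = (of_bool (r = c)
    - (of_bool (ones n r = {} \<and> ones n c = {}) + of_bool (ones n r = {1..n} \<and> ones n c = {1..n}))
    - (\<Sum>k=1..n. (((- 1) ^ k / of_nat n) \<cdot>\<^sub>m tensor_mat (map (A k) [1..<n + 1])) $$ (r, c))) / 2"
  using assms tensor_z_projector_index[of r n c]
  by (simp add: witness_decomposition_def mat_Sum_def z_projector_def)

text \<open>Compared entrywise: summing over the settings kills all rows except the all-zero and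
  all-one ones, and the flip condition then fixes the column as the opposite extreme. Together with
  the two projectors this fills the four corners.\<close>

lemma W_GHZ_decomposition:
  assumes "0 < n"
  shows "W_GHZ n = witness_decomposition n (M_obs n)"
proof (rule eq_matI)
  show "dim_row (W_GHZ n) = dim_row (witness_decomposition n (M_obs n))"
    "dim_col (W_GHZ n) = dim_col (witness_decomposition n (M_obs n))"
    using carrier_matD[OF W_GHZ_carrier[of n]] by (simp_all add: witness_decomposition_def mat_Sum_def)
  fix r c
  assume "r < dim_row (witness_decomposition n (M_obs n))" "c < dim_col (witness_decomposition n (M_obs n))"
  then have rc: "r < 2 ^ n" "c < 2 ^ n" by (simp_all add: witness_decomposition_def mat_Sum_def)
  let ?a = "card (ones n r)" and ?anti = "ones n c = {1..n} - ones n r"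
  have a: "?a \<le> n" using card_mono[OF _ ones_subset[of n r]] by simp
  have a0: "?a = 0 \<longleftrightarrow> ones n r = {}" using finite_subset[OF ones_subset[of n r]] by simp
  have an: "?a = n \<longleftrightarrow> ones n r = {1..n}"
    using card_subset_eq[OF _ ones_subset[of n r]] by auto
  have "(((- 1) ^ k / of_nat n) \<cdot>\<^sub>m tensor_mat (map (M_obs n k) [1..<n + 1])) $$ (r, c)
      = of_bool ?anti / of_nat n * cis (2 * pi * real ?a / real n) ^ k" for k
  proof -
    have "map (M_obs n k) [1..<n + 1] = replicate n (xy_observable (real k * pi / real n))"
      by (rule nth_equalityI) (auto simp: M_obs_def simp del: upt_Suc)
    moreover have "(- 1) ^ k * cis ((2 * real ?a - real n) * (real k * pi / real n))
        = cis (2 * pi * real ?a / real n) ^ k"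
    proof -
      \<comment> \<open>The sign \<open>(- 1) ^ k\<close> is the phase \<open>k * pi\<close>, which
        cancels the offset \<open>- real n\<close> in \<open>2 * real ?a - real n\<close> and leaves
        a power of a root of unity.\<close>
      have "cis (2 * pi * real ?a / real n) ^ k
          = cis (real k * pi + (2 * real ?a - real n) * (real k * pi / real n))"
        using assms by (auto simp: DeMoivre field_simps intro!: arg_cong[where f = cis])
      also have "\<dots> = cis pi ^ k * cis ((2 * real ?a - real n) * (real k * pi / real n))"
        by (simp only: cis_mult DeMoivre)
      finally show ?thesis by simp
    qed
    ultimately show ?thesis
      using rc dim_tensor_mat[of "replicate n (xy_observable (real k * pi / real n))"]
      by (auto simp: tensor_xy_index)
  qed
  then have "(\<Sum>k=1..n. (((- 1) ^ k / of_nat n) \<cdot>\<^sub>m tensor_mat (map (M_obs n k) [1..<n + 1])) $$ (r, c))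
      = of_bool ?anti / of_nat n * (\<Sum>k=1..n. cis (2 * pi * real ?a / real n) ^ k)"
    by (simp only: sum_distrib_left)
  also have "\<dots> = of_bool ?anti * of_bool (ones n r = {} \<or> ones n r = {1..n})"
    unfolding sum_cis_multiples[OF assms a] a0 an using assms by simp
  also have "\<dots> = of_bool (ones n r = {} \<and> ones n c = {1..n})
      + of_bool (ones n r = {1..n} \<and> ones n c = {})"
    using assms by auto
  \<comment> \<open>The four corner indicators combine into a product of a row factor and a column
    factor, as in a rank-one projector.\<close>
  finally have "witness_decomposition n (M_obs n) $$ (r, c) = (of_bool (r = c)
      - (of_bool (ones n r = {}) + of_bool (ones n r = {1..n}))
      * (of_bool (ones n c = {}) + of_bool (ones n c = {1..n}))) / 2"
    unfolding witness_decomposition_index[OF rc] by (simp add: of_bool_conj algebra_simps)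
  also have "\<dots> = W_GHZ n $$ (r, c)"
  proof -
    have "ghz n $ i = (of_bool (ones n i = {}) + of_bool (ones n i = {1..n})) / of_real (sqrt 2)"
      if "i < 2 ^ n" for i
      using that by (simp add: ghz_eq_cat_vec cat_vec_index)
    moreover have "of_real (sqrt 2) * of_real (sqrt 2) = (2 :: complex)"
      by (simp flip: of_real_mult)
    ultimately show ?thesis
      using rc by (simp add: W_GHZ_def ketbra_def diff_divide_distrib)
  qed
  finally show "W_GHZ n $$ (r, c) = witness_decomposition n (M_obs n) $$ (r, c)" ..
qed

section \<open>The biseparable state\<close>

lemma psi_eq_cat_vec:
  "psi n = (1 / 2) \<cdot>\<^sub>v kron_vec (cat_vec (n div 2) (cis (pi / 4))) (cat_vec (n div 2) (cis (- pi / 4)))"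
  by (simp add: psi_def cat_vec_def cis_conv_exp)

lemma power_half_square: "even n \<Longrightarrow> 2 ^ (n div 2) * 2 ^ (n div 2) = (2 :: nat) ^ n"
  by (simp flip: power_add mult_2)

lemma psi_carrier: "even n \<Longrightarrow> psi n \<in> carrier_vec (2 ^ n)"
  using kron_vec_carrier[OF cat_vec_carrier cat_vec_carrier, of "n div 2" _ "n div 2"]
  by (simp add: psi_eq_cat_vec power_half_square)

text \<open>An observable split along the cut of the state factorizes; the quarter is the squared
  modulus of the prefactor of \<open>psi n\<close>.\<close>

lemma expectation_kron_psi:
  assumes "even n" "A \<in> carrier_mat (2 ^ (n div 2)) (2 ^ (n div 2))"
    "B \<in> carrier_mat (2 ^ (n div 2)) (2 ^ (n div 2))"
  shows "expectation (kron_mat A B) (psi n)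
    = expectation A (cat_vec (n div 2) (cis (pi / 4))) * expectation B (cat_vec (n div 2) (cis (- pi / 4))) / 4"
proof -
  let ?u = "cat_vec (n div 2) (cis (pi / 4))" and ?w = "cat_vec (n div 2) (cis (- pi / 4))"
  have "kron_mat A B \<in> carrier_mat (2 ^ n) (2 ^ n)" "kron_vec ?u ?w \<in> carrier_vec (2 ^ n)"
    using kron_mat_carrier[OF assms(2,3)] kron_vec_carrier[OF cat_vec_carrier cat_vec_carrier, of "n div 2" _ "n div 2"]
    by (simp_all add: power_half_square assms(1))
  then have "expectation (kron_mat A B) (psi n) = 1 / 4 * expectation (kron_mat A B) (kron_vec ?u ?w)"
    unfolding psi_eq_cat_vec by (subst expectation_smult_vec) auto
  also have "expectation (kron_mat A B) (kron_vec ?u ?w) = expectation A ?u * expectation B ?w"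
    using assms by (intro expectation_kron) auto
  finally show ?thesis by simp
qed

text \<open>Each of the two factors has squared norm 2, which the squared prefactor 1/4
  compensates.\<close>

lemma state_vec_psi:
  assumes "0 < n" "even n"
  shows "state_vec n (psi n)"
proof -
  let ?u = "cat_vec (n div 2) (cis (pi / 4))" and ?w = "cat_vec (n div 2) (cis (- pi / 4))"
  have h: "0 < n div 2" using assms by auto
  have k: "kron_vec ?u ?w \<in> carrier_vec (2 ^ n)"
    using kron_vec_carrier[OF cat_vec_carrier cat_vec_carrier, of "n div 2" _ "n div 2"] assms
    by (simp add: power_half_square)
  have "psi n \<bullet>c psi n = expectation (1\<^sub>m (2 ^ n)) (psi n)"
    using assms psi_carrier by (simp add: expectation_one)
  also have "\<dots> = 1 / 4 * (kron_vec ?u ?w \<bullet>c kron_vec ?u ?w)"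
    unfolding psi_eq_cat_vec using k by (subst expectation_smult_vec) (auto simp: expectation_one)
  also have "\<dots> = 1"
    using h by (subst inner_kron[OF cat_vec_carrier cat_vec_carrier]) (simp add: inner_cat_vec)
  finally show ?thesis using assms psi_carrier by (simp add: state_vec_def)
qed

lemma biseparable_vec_psi:
  assumes "0 < n" "even n"
  shows "biseparable_vec n (psi n)"
proof -
  define h where "h = n div 2"
  have n: "n = h + h" "0 < h" using assms by (auto simp: h_def)
  \<comment> \<open>The cut separates the two halves of the qubits. The normalization goes into
    \<open>a\<close>, and \<open>b\<close> is indexed by the original qubit numbers
    \<open>h + 1\<close> to \<open>n\<close>.\<close>
  define a where "a T = (of_bool (T = {}) + cis (pi / 4) * of_bool (T = {1..h})) / 2" for T
  define b where "b T = of_bool (T = {}) + cis (- pi / 4) * of_bool (T = {h + 1..n})" for T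
  have "psi n $ i = a (ones n i \<inter> {1..h}) * b (ones n i - {1..h})" if i: "i < 2 ^ n" for i
  proof -
    let ?d = "i div 2 ^ h" and ?m = "i mod 2 ^ h"
    have i': "i < 2 ^ h * 2 ^ h" using i n by (simp add: power_add)
    have lt: "?d < 2 ^ h" "?m < 2 ^ h" using i' by (auto simp: less_mult_imp_div_less)
    \<comment> \<open>Qubit \<open>j\<close> of the remainder is qubit \<open>j + h\<close> of the
      whole register; injectivity of the shift transfers both label comparisons in
      \<open>b\<close>.\<close>
    have "ones n i - {1..h} = (\<lambda>j. j + h) ` ones h ?m"
    proof (intro equalityI subsetI)
      fix j assume "j \<in> ones n i - {1..h}"
      then have "j - h \<in> ones h ?m" "j = j - h + h"
        using ones_mod[of "j - h" h i h] ones_subset[of n i] n by auto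
      then show "j \<in> (\<lambda>j. j + h) ` ones h ?m" by blast
    qed (use ones_mod[of _ h i h] n in auto)
    moreover have "{h + 1..n} = (\<lambda>j. j + h) ` {1..h}" using n by (simp add: image_add_atLeastAtMost')
    moreover have "inj (\<lambda>j. j + h)" by simp
    ultimately have b: "b (ones n i - {1..h}) = cat_vec h (cis (- pi / 4)) $ ?m"
      by (simp only: b_def cat_vec_index[OF lt(2)] inj_image_eq_iff image_is_empty)
    have "a (ones n i \<inter> {1..h}) = cat_vec h (cis (pi / 4)) $ ?d / 2"
      using lt ones_div[of h i h] n by (simp add: a_def cat_vec_index)
    moreover have "psi n $ i = cat_vec h (cis (pi / 4)) $ ?d / 2 * cat_vec h (cis (- pi / 4)) $ ?m"
      using i'
      unfolding psi_eq_cat_vec h_def[symmetric] by (simp add: kron_vec_def)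
    ultimately show ?thesis by (simp only: b)
  qed
  then have "product_across n {1..h} (psi n)" by (auto simp: product_across_def)
  moreover have "{1..h} \<noteq> {}" "{1..h} \<subset> {1..n}" using n by auto
  ultimately show ?thesis
    using state_vec_psi[OF assms] unfolding biseparable_vec_def by blast
qed

lemma biseparable_state_ketbra:
  assumes "biseparable_vec n v"
  shows "biseparable_state n (ketbra v v)"
proof -
  have "v \<in> carrier_vec (2 ^ n)" using assms by (simp add: biseparable_vec_def state_vec_def)
  then have "ketbra v v = mat_Sum (2 ^ n) (\<lambda>i. complex_of_real 1 \<cdot>\<^sub>m ketbra v v) {..<1 :: nat}"
    by (auto simp: mat_Sum_def ketbra_def)
  then show ?thesis
    using assms unfolding biseparable_state_def
    by (intro exI[of _ 1] exI[of _ "\<lambda>_. 1"] exI[of _ "\<lambda>_. v"]) auto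
qed

section \<open>Misaligned expectation values\<close>

lemma map_N_obs:
  assumes "even n"
  shows "map (N_obs n \<epsilon> k) [1..<n + 1] =
    replicate (n div 2) (xy_observable (real k * pi / real n + (- 1) ^ k * \<epsilon>)) @
    replicate (n div 2) (xy_observable (real k * pi / real n - (- 1) ^ k * \<epsilon>))"
  using assms by (intro nth_equalityI) (auto simp: N_obs_def nth_append simp del: upt_Suc)

lemma tensor_replicate_even:
  "even n \<Longrightarrow> tensor_mat (replicate n A)
    = kron_mat (tensor_mat (replicate (n div 2) A)) (tensor_mat (replicate (n div 2) A))"
  by (simp flip: tensor_mat_append replicate_add mult_2)

text \<open>Product-to-sum formula: the offsets \<pi>/4 cancel in the sum of the angles, leaving
  \<open>real k * pi\<close>, but add up in their difference to the shift \<pi>/2 that turns the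
  cosine into a sine.\<close>

lemma expectation_N_obs_psi:
  assumes "0 < n" "even n"
  shows "expectation (tensor_mat (map (N_obs n \<epsilon> k) [1..<n + 1])) (psi n)
    = of_real ((- 1) ^ k * (1 + sin (real n * \<epsilon>)) / 2)"
proof -
  define h where "h = n div 2"
  have n: "n = 2 * h" "0 < h" using assms by (auto simp: h_def)
  define s :: real where "s = (- 1) ^ k"
  let ?p = "real h * (real k * pi / real n + s * \<epsilon>)" and ?m = "real h * (real k * pi / real n - s * \<epsilon>)"
  have c: "tensor_mat (replicate h (xy_observable \<theta>)) \<in> carrier_mat (2 ^ h) (2 ^ h)" for \<theta>
    using dim_tensor_mat[of "replicate h (xy_observable \<theta>)"] by auto
  \<comment> \<open>The factors 2 of the two cosines cancel the quarter from
    \<open>psi n\<close>.\<close>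
  have "expectation (tensor_mat (map (N_obs n \<epsilon> k) [1..<n + 1])) (psi n)
      = of_real (cos (?p - pi / 4) * cos (?m + pi / 4))"
    unfolding map_N_obs[OF assms(2)] tensor_mat_append
    using c n(2) by (subst expectation_kron_psi[OF assms(2)])
      (simp_all add: expectation_xy_cat s_def flip: h_def)
  also have "cos (?p - pi / 4) * cos (?m + pi / 4)
      = (cos (real k * pi) + cos (s * (real n * \<epsilon>) - pi / 2)) / 2"
  proof -
    have "?p + ?m = real k * pi" using n by (simp add: field_simps)
    then have "?p - pi / 4 + (?m + pi / 4) = real k * pi" by simp
    moreover have "?p - ?m = s * (real n * \<epsilon>)" using n by (simp add: algebra_simps)
    then have "?p - pi / 4 - (?m + pi / 4) = s * (real n * \<epsilon>) - pi / 2" by simp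
    ultimately show ?thesis by (simp only: cos_times_cos add.commute)
  qed
  also have "cos (real k * pi) = s" by (simp add: s_def)
  also have "cos (s * (real n * \<epsilon>) - pi / 2) = s * sin (real n * \<epsilon>)"
    by (cases "even k") (auto simp: s_def cos_diff)
  finally show ?thesis by (simp add: s_def algebra_simps)
qed

lemma tensor_N_obs_carrier:
  "tensor_mat (map (N_obs n \<epsilon> k) [1..<n + 1]) \<in> carrier_mat (2 ^ n) (2 ^ n)"
proof -
  have "N_obs n \<epsilon> k j \<in> carrier_mat 2 2" for j by (simp add: N_obs_def)
  then show ?thesis using dim_tensor_mat[of "map (N_obs n \<epsilon> k) [1..<n + 1]"] by (auto simp del: upt_Suc)
qed

lemma W_eps_carrier: "W_eps n \<epsilon> \<in> carrier_mat (2 ^ n) (2 ^ n)"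
  by (simp add: W_eps_def witness_decomposition_def minus_carrier_mat)

text \<open>The identity gives 1, the projectors 1/2 and the settings (1 + sin(n \<epsilon>))/2. At
  \<epsilon> = 0 they balance exactly, so the misalignment alone decides the sign.\<close>

lemma expectation_W_eps_psi:
  assumes "0 < n" "even n"
  shows "expectation (W_eps n \<epsilon>) (psi n) = complex_of_real (- (1 / 4) * sin (real n * \<epsilon>))"
proof -
  let ?D = "2 ^ n" and ?T = "\<lambda>k. tensor_mat (map (N_obs n \<epsilon> k) [1..<n + 1])"
  let ?P = "\<lambda>l. tensor_mat (replicate n (z_projector l))"
  have \<psi>: "psi n \<in> carrier_vec ?D" "psi n \<bullet>c psi n = 1"
    using state_vec_psi[OF assms] by (auto simp: state_vec_def)
  have P: "?P l \<in> carrier_mat ?D ?D" for l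
    using dim_tensor_mat[of "replicate n (z_projector l)"] by auto
  have EP: "expectation (?P l) (psi n) = 1 / 4" if "l \<in> {1, - 1}" for l
  proof -
    have "tensor_mat (replicate (n div 2) (z_projector l)) \<in> carrier_mat (2 ^ (n div 2)) (2 ^ (n div 2))"
      using dim_tensor_mat[of "replicate (n div 2) (z_projector l)"] by auto
    moreover have "0 < n div 2" using assms by auto
    ultimately show ?thesis
      unfolding tensor_replicate_even[OF assms(2)] using that
      by (subst expectation_kron_psi[OF assms(2)]) (simp_all only: expectation_z_projector_cat norm_cis, simp)
  qed
  have "expectation (W_eps n \<epsilon>) (psi n) = 1 / 2 * (1 - (\<Sum>l\<in>{1, - 1}. expectation (?P l) (psi n))
      - (\<Sum>k=1..n. (- 1) ^ k / of_nat n * expectation (?T k) (psi n)))"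
    unfolding W_eps_def witness_decomposition_def z_projector_def[symmetric]
    using \<psi> P tensor_N_obs_carrier[of n \<epsilon>]
    by (simp add: expectation_smult[of _ ?D] expectation_minus[of _ ?D] expectation_mat_Sum[of _ _ ?D]
        expectation_one minus_carrier_mat del: upt_Suc)
  also have "(\<Sum>l\<in>{1, - 1}. expectation (?P l) (psi n)) = 1 / 2" by (simp add: EP)
  also have "(\<Sum>k=1..n. (- 1) ^ k / of_nat n * expectation (?T k) (psi n))
      = (\<Sum>k=1..n. of_real ((1 + sin (real n * \<epsilon>)) / 2) / of_nat n)"
  proof (intro sum.cong refl)
    fix k
    \<comment> \<open>The sign of the setting meets the same sign in its expectation, so all
      \<open>n\<close> settings contribute equally and the errors add up instead of averaging
      out.\<close>
    have "(- 1) ^ k * ((- 1) ^ k * x) = x" for x :: complex by (simp flip: power_add mult.assoc)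
    then show "(- 1) ^ k / of_nat n * expectation (?T k) (psi n)
        = of_real ((1 + sin (real n * \<epsilon>)) / 2) / of_nat n"
      unfolding expectation_N_obs_psi[OF assms] by simp
  qed
  also have "\<dots> = of_real ((1 + sin (real n * \<epsilon>)) / 2)" using assms by simp
  finally show ?thesis by (simp add: field_simps)
qed

theorem mainTheorem5:
  fixes n :: nat and \<epsilon> :: real
  assumes "4 \<le> n" and "even n" and "0 \<le> \<epsilon>" and "\<epsilon> \<le> pi / (2 * real n)"
  shows "gme_witness n (W_GHZ n)
    \<and> W_GHZ n = witness_decomposition n (M_obs n)
    \<and> biseparable_vec n (psi n)
    \<and> expectation (W_eps n \<epsilon>) (psi n) = complex_of_real (- (1 / 4) * sin (real n * \<epsilon>))
    \<and> (0 < \<epsilon> \<longrightarrow>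
         Re (expectation (W_eps n \<epsilon>) (psi n)) < 0
         \<and> biseparable_state n (ketbra (psi n) (psi n))
         \<and> Re (trace (W_eps n \<epsilon> * ketbra (psi n) (psi n))) < 0)"
proof -
  have n: "0 < n" using assms by simp
  \<comment> \<open>The bound on \<epsilon> keeps \<open>real n * \<epsilon>\<close> at most
    \<pi>/2, inside the interval where the sine is positive.\<close>
  have "0 < sin (real n * \<epsilon>)" if "0 < \<epsilon>"
  proof (rule sin_gt_zero)
    have "real n * \<epsilon> \<le> real n * (pi / (2 * real n))" using assms by (intro mult_left_mono) auto
    also have "\<dots> = pi / 2" using n by simp
    also have "\<dots> < pi" by simp
    finally show "real n * \<epsilon> < pi" .
  qed (use that n in simp)
  then show ?thesis
    using gme_witness_W_GHZ[OF n] W_GHZ_decomposition[OF n] biseparable_vec_psi[OF n assms(2)]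
      biseparable_state_ketbra expectation_W_eps_psi[OF n assms(2), of \<epsilon>]
      trace_mult_ketbra[OF W_eps_carrier psi_carrier[OF assms(2)], of \<epsilon>]
    by simp
qed

end
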